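(* Let $k,n$ be positive integers with $n\ge 6$, $k\le n/2$, and $$\frac{2^n}{n+1}<\binom nk\le \frac{2^n}n.$$ Then $k=f(n)$, where $f(n)$ is the least positive integer $r$ such that $\binom nr>\frac{2^n}{n+1}$.
   Context: For an integer $n\ge 3$, $f(n)$ denotes the least positive integer $r$ such that $\binom nr>\frac{2^n}{n+1}$. *)

theory Defs
  imports Complex_Main
begin

text \<open>The mathematical definition is for \<open>n \<ge> 3\<close>, where such an \<open>r\<close> always exists.\<close>

definition f :: "nat \<Rightarrow> nat" where
  "f n = (LEAST r. 0 < r \<and> real (n choose r) > 2 ^ n / (real n + 1))"

end

theory Submission
  imports Defs
begin

text \<open>If \<open>f n < k\<close>, then by unimodality already \<open>n choose (k - 1)\<close> exceeds \<open>2 ^ n / (n + 1)\<close>.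
  Hence the ratio \<open>(n - k + 1) / k\<close> of the consecutive coefficients is below
  \<open>(n + 1) / n\<close>, which is impossible for \<open>k \<le> n / 2\<close>.\<close>

text \<open>Both sides equal \<open>n * ((n - 1) choose j)\<close>.\<close>

lemma Suc_times_binomial_Suc: "Suc j * (n choose Suc j) = (n - j) * (n choose j)"
  by (simp only: binomial_absorption binomial_absorb_comp)

text \<open>Consecutive coefficients have ratio \<open>(n - j) / Suc j\<close>, so it suffices that
  \<open>Suc j * (n + 1) \<le> n * (n - j)\<close>.\<close>

lemma binomial_Suc_ratio:
  fixes j n :: nat
  assumes "2 * Suc j \<le> n"
  shows "(n + 1) * (n choose j) \<le> n * (n choose Suc j)"
proof -
  have "Suc j * (n + 1) \<le> n * (n - j)"
  proof -
    have "2 * (Suc j * (n + 1)) \<le> n * (n + 1)"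
      using mult_le_mono1[OF assms, of "n + 1"] by (simp only: mult.assoc)
    \<comment> \<open>The hypothesis gives \<open>2 * (n - j) \<ge> n + 2\<close>.\<close>
    also have "\<dots> \<le> n * (2 * (n - j))"
      using assms by (intro mult_le_mono2) simp
    finally show ?thesis by simp
  qed
  then have "Suc j * (n + 1) * (n choose j) \<le> n * (n - j) * (n choose j)"
    by (rule mult_le_mono1)
  also have "\<dots> = Suc j * (n * (n choose Suc j))"
    using Suc_times_binomial_Suc[of j n] by (metis mult.assoc mult.left_commute)
  finally show ?thesis
    by (simp only: mult.assoc Suc_mult_le_cancel1)
qed

theorem theorem2p5:
  fixes k n :: nat
  assumes "0 < k" and "0 < n" and "n \<ge> 6" and "real k \<le> real n / 2"
    and "2 ^ n / (real n + 1) < real (n choose k)"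
    and "real (n choose k) \<le> 2 ^ n / real n"
  shows "k = f n"
proof -
  have "2 * k \<le> n" using assms(4) by linarith
  have "k \<le> r" if r: "0 < r" "2 ^ n / (real n + 1) < real (n choose r)" for r
  proof (rule ccontr)
    assume "\<not> k \<le> r"
    then obtain j where k: "k = Suc j" and "r \<le> j" by (cases k) auto
    then have "n choose r \<le> n choose j"
      using \<open>2 * k \<le> n\<close> by (intro binomial_mono) auto
    then have "2 ^ n / (real n + 1) < real (n choose j)"
      using r(2) by linarith
    \<comment> \<open>With denominators cleared, the ratio bound links the lower bound at
      \<open>j\<close> to the upper bound at \<open>k = Suc j\<close>, giving
      \<open>2 ^ n < 2 ^ n\<close>.\<close>
    then have "2 ^ n < real ((n + 1) * (n choose j))"
      by (simp add: field_simps)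
    also have "\<dots> \<le> real (n * (n choose k))"
      using binomial_Suc_ratio \<open>2 * k \<le> n\<close> k by (simp only: of_nat_le_iff)
    also have "\<dots> \<le> 2 ^ n"
      using assms(2,6) by (simp add: field_simps)
    finally show False by simp
  qed
  then show ?thesis
    unfolding f_def using assms(1,5) by (intro Least_equality[symmetric]) auto
qed

end
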